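(* Let $K$ be a compact Hausdorff space and let $E$ be a real Banach space that is a GL-space. Then $C(K,E)$ is a GL-space.
   Context: All spaces are over the real field. $B_E$, $S_E$, $E^*$ denote the closed unit ball, the unit sphere and the dual of $E$. $C(K,E)$ is the Banach space of all continuous functions from $K$ into $E$ with the supremum norm. A Banach space $E$ is a GL-space (generalized-lush space) if for every $x\in S_E$ and every $\varepsilon>0$ there is $x^*\in S_{E^*}$ such that, with $S=S(x^*,\varepsilon)=\{z\in B_E: x^*(z)>1-\varepsilon\}$, one has $x\in S$ and $\mathrm{dist}(y,S)+\mathrm{dist}(y,-S)<2+\varepsilon$ for all $y\in S_E$. *)

theory Defs
  imports "HOL-Analysis.Analysis"
begin

text \<open>The dual of \<open>'e\<close> is \<open>'e \<Rightarrow>\<^sub>L real\<close>.\<close>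

definition slice :: "('e::real_normed_vector \<Rightarrow>\<^sub>L real) \<Rightarrow> real \<Rightarrow> 'e set"
  where "slice f \<epsilon> = {z \<in> cball 0 1. blinfun_apply f z > 1 - \<epsilon>}"

text \<open>
  \<^const>\<open>infdist\<close> is \<open>0\<close> for the empty set; here the slice contains \<open>x\<close>, so both it and its
  negative are nonempty.  The argument of type \<open>'e itself\<close> only names the space.
\<close>

definition GL_space :: "'e::banach itself \<Rightarrow> bool"
  where "GL_space _ \<longleftrightarrow>
    (\<forall>x \<in> sphere (0::'e) 1. \<forall>\<epsilon>>0. \<exists>f \<in> sphere (0 :: 'e \<Rightarrow>\<^sub>L real) 1.
      x \<in> slice f \<epsilon> \<and>
      (\<forall>y \<in> sphere (0::'e) 1.
        infdist y (slice f \<epsilon>) + infdist y (uminus ` slice f \<epsilon>) < 2 + \<epsilon>))"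

text \<open>
  A compact Hausdorff space \<open>K\<close> is a type \<open>'k::t2_space\<close> with compact universe.  Every continuous
  function on it is then bounded, so \<open>C(K,E)\<close> with the supremum norm is the library type
  \<open>'k \<Rightarrow>\<^sub>C 'e\<close> of bounded continuous functions.
\<close>

text \<open>
  The library shows that \<open>'k \<Rightarrow>\<^sub>C 'e\<close> is complete only for metric \<open>'k\<close>; its proof works
  for every topological space.
\<close>

instance bcontfun :: (topological_space, complete_space) complete_space
proof
  fix f :: "nat \<Rightarrow> ('a, 'b) bcontfun"
  assume "Cauchy f"
  then obtain g where "uniform_limit UNIV f g sequentially"
    using uniformly_convergent_eq_cauchy[of "\<lambda>_. True" f]
    unfolding Cauchy_def uniform_limit_sequentially_iff
    by (metis dist_fun_lt_imp_dist_val_lt)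
  from uniform_limit_bcontfunE[OF this sequentially_bot]
  obtain l' where "g = apply_bcontfun l'" "(f \<longlonglongrightarrow> l')" by metis
  then show "convergent f"
    by (intro convergentI)
qed

instance bcontfun :: (topological_space, banach) banach ..

end

theory Submission
  imports Defs
begin

text \<open>
  A function \<open>u\<close> of norm one attains its norm at some \<open>t\<close>, and if \<open>f\<close> is a functional given by the
  GL-property of \<open>E\<close> at \<open>u t\<close>, then \<open>g \<mapsto> f (g t)\<close> works at \<open>u\<close>: a function \<open>g\<close> can be pushed
  into the slice by changing it only near \<open>t\<close>, at the cost of the distance from \<open>g t\<close> to the slice
  in \<open>E\<close>.  As \<open>g t\<close> may lie inside the ball, the inequality has to be extended there from the
  sphere.
\<close>

lemma le_infdist:
  assumes "A \<noteq> {}" and "\<And>a. a \<in> A \<Longrightarrow> m \<le> dist x a"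
  shows "m \<le> infdist x A"
  using assms by (auto simp: infdist_notempty intro: cINF_greatest)

lemma infdist_uminus_image:
  fixes A :: "'a::real_normed_vector set"
  shows "infdist y (uminus ` A) = infdist (- y) A"
proof -
  have "dist y (- a) = dist (- y) a" for a
    by (metis dist_minus minus_minus)
  then show ?thesis
    by (simp add: infdist_def image_image)
qed

text \<open>For \<open>a\<close> in \<open>A\<close>,
  \<open>r u - a = r (u - a) - (1 - r) a\<close>, and the last term has norm at most
  \<open>1 - r\<close> because \<open>A\<close> lies in the unit ball. The infimum over
  \<open>a\<close> gives the claim.\<close>

lemma infdist_scaleR_le:
  fixes A :: "'a::real_normed_vector set"
  assumes "A \<noteq> {}" "A \<subseteq> cball 0 1" "0 \<le> r" "r \<le> 1"
  shows "infdist (r *\<^sub>R u) A \<le> r * infdist u A + (1 - r)"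
proof (cases "r = 0")
  case True
  obtain a where a: "a \<in> A"
    using assms by blast
  then have "infdist 0 A \<le> dist 0 a"
    by (rule infdist_le)
  also have "\<dots> \<le> 1"
    using a assms by auto
  finally show ?thesis
    using True by simp
next
  case False
  with assms have r: "r > 0"
    by simp
  \<comment> \<open>Solving for \<open>infdist u A\<close> leaves a bound to be checked at each
    point of \<open>A\<close>; the division by \<open>r\<close> is why \<open>r = 0\<close> is a
    separate case.\<close>
  have "(infdist (r *\<^sub>R u) A - (1 - r)) / r \<le> infdist u A"
  proof (rule le_infdist)
    fix a assume a: "a \<in> A"
    have "infdist (r *\<^sub>R u) A \<le> dist (r *\<^sub>R u) a"
      using a by (rule infdist_le)
    also have "\<dots> = norm (r *\<^sub>R (u - a) - (1 - r) *\<^sub>R a)"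
      by (simp add: dist_norm algebra_simps)
    also have "\<dots> \<le> r * norm (u - a) + (1 - r) * norm a"
      using assms by (metis norm_triangle_ineq4 norm_scaleR abs_of_nonneg diff_ge_0_iff_ge)
    also have "\<dots> \<le> r * dist u a + (1 - r)"
    proof -
      have "norm a \<le> 1"
        using a assms(2) by auto
      then show ?thesis
        using assms(4) by (simp add: dist_norm mult_left_le)
    qed
    finally show "(infdist (r *\<^sub>R u) A - (1 - r)) / r \<le> dist u a"
      using r by (simp add: field_simps)
  qed (use assms in simp)
  then show ?thesis
    using r by (simp add: field_simps)
qed

text \<open>With \<open>y = r u\<close> and \<open>u\<close> on the sphere, the bounds for
  \<open>u\<close> and \<open>- u\<close> add up to less than
  \<open>r (2 + \<epsilon>) + 2 (1 - r) = 2 + r \<epsilon>\<close>.\<close>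

lemma infdist_add_infdist_uminus_less:
  fixes A :: "'a::banach set"
  assumes A: "A \<noteq> {}" "A \<subseteq> cball 0 1" and "\<epsilon> > 0" and y: "norm y \<le> 1"
    and sphere: "\<And>u. u \<in> sphere 0 1 \<Longrightarrow> infdist u A + infdist (- u) A < 2 + \<epsilon>"
  shows "infdist y A + infdist (- y) A < 2 + \<epsilon>"
proof (cases "y = 0")
  case True
  then show ?thesis
    using infdist_scaleR_le[OF A, of 0 y] \<open>\<epsilon> > 0\<close> by simp
next
  case False
  define r where "r = norm y"
  define u where "u = y /\<^sub>R r"
  have r: "0 < r" "r \<le> 1" and u: "u \<in> sphere 0 1" and eq: "y = r *\<^sub>R u"
    using False y by (auto simp: r_def u_def)
  have "infdist y A + infdist (- y) A \<le> r * (infdist u A + infdist (- u) A) + 2 * (1 - r)"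
    using infdist_scaleR_le[OF A, of r u] infdist_scaleR_le[OF A, of r "- u"] r
    by (simp add: eq algebra_simps)
  also have "\<dots> < r * (2 + \<epsilon>) + 2 * (1 - r)"
    using sphere[OF u] r by simp
  also have "\<dots> \<le> 2 + \<epsilon>"
    using r \<open>\<epsilon> > 0\<close> by (simp add: algebra_simps)
  finally show ?thesis .
qed

lemma bounded_linear_apply_bcontfun:
  "bounded_linear (\<lambda>g :: 'k::topological_space \<Rightarrow>\<^sub>C 'e::real_normed_vector. apply_bcontfun g t)"
  by (rule bounded_linear_intro[where K = 1]) (auto simp: norm_bounded)

definition eval_blinfun ::
    "'k::topological_space \<Rightarrow> ('e::real_normed_vector \<Rightarrow>\<^sub>L 'f) \<Rightarrow>
      ('k \<Rightarrow>\<^sub>C 'e) \<Rightarrow>\<^sub>L 'f::real_normed_vector"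
  where "eval_blinfun t f = Blinfun (\<lambda>g. blinfun_apply f (apply_bcontfun g t))"

lemma eval_blinfun_apply [simp]:
  "blinfun_apply (eval_blinfun t f) g = blinfun_apply f (apply_bcontfun g t)"
  unfolding eval_blinfun_def
  by (subst bounded_linear_Blinfun_apply)
    (auto intro: bounded_linear_compose[OF blinfun.bounded_linear_right bounded_linear_apply_bcontfun])

text \<open>Evaluation at \<open>t\<close> does not increase norms, and on constant functions the
  functional acts as \<open>f\<close>, which gives the reverse inequality.\<close>

lemma norm_eval_blinfun [simp]:
  "norm (eval_blinfun t f) = norm f"
proof (rule antisym)
  show "norm (eval_blinfun t f) \<le> norm f"
  proof (rule norm_blinfun_bound)
    fix g
    have "norm (blinfun_apply f (apply_bcontfun g t)) \<le> norm f * norm (apply_bcontfun g t)"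
      by (rule norm_blinfun)
    also have "\<dots> \<le> norm f * norm g"
      by (intro mult_left_mono norm_bounded norm_ge_zero)
    finally show "norm (blinfun_apply (eval_blinfun t f) g) \<le> norm f * norm g"
      by simp
  qed simp
  show "norm f \<le> norm (eval_blinfun t f)"
  proof (rule norm_blinfun_bound)
    fix x
    have "norm (blinfun_apply f x) = norm (blinfun_apply (eval_blinfun t f) (const_bcontfun x))"
      by simp
    also have "\<dots> \<le> norm (eval_blinfun t f) * norm (const_bcontfun x :: 'a \<Rightarrow>\<^sub>C 'b)"
      by (rule norm_blinfun)
    also have "\<dots> \<le> norm (eval_blinfun t f) * norm x"
      by (intro mult_left_mono norm_bound) auto
    finally show "norm (blinfun_apply f x) \<le> norm (eval_blinfun t f) * norm x" .
  qed simp
qed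

text \<open>Each \<open>z\<close> in the slice of \<open>f\<close> is the value at \<open>t\<close>
  of some \<open>h\<close> in the unit ball with \<open>dist g h\<close> at most
  \<open>dist (g t) z + \<eta>\<close>, for arbitrary \<open>\<eta> > 0\<close>.\<close>

lemma infdist_slice_eval_blinfun_le:
  fixes g :: "'k::topological_space \<Rightarrow>\<^sub>C 'e::real_normed_vector"
  assumes ne: "slice f \<epsilon> \<noteq> {}" and g: "norm g \<le> 1"
  shows "infdist g (slice (eval_blinfun t f) \<epsilon>) \<le> infdist (apply_bcontfun g t) (slice f \<epsilon>)"
proof (rule le_infdist[OF ne])
  fix z assume z: "z \<in> slice f \<epsilon>"
  let ?y = "apply_bcontfun g t"
  have nz: "norm z \<le> 1" and fz: "blinfun_apply f z > 1 - \<epsilon>"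
    using z by (auto simp: slice_def)
  show "infdist g (slice (eval_blinfun t f) \<epsilon>) \<le> dist ?y z"
  proof (rule field_le_epsilon)
    fix \<eta> :: real assume \<eta>: "\<eta> > 0"
    \<comment> \<open>\<open>\<phi>\<close> is a bump at \<open>t\<close> built from \<open>g\<close> itself, so Urysohn's lemma is not needed.\<close>
    define \<phi> where "\<phi> s = max 0 (1 - norm (apply_bcontfun g s - ?y) / \<eta>)" for s
    have \<phi>: "0 \<le> \<phi> s" "\<phi> s \<le> 1" for s
      using \<eta> by (auto simp: \<phi>_def)
    have \<phi>t: "\<phi> t = 1"
      by (simp add: \<phi>_def)
    define h where "h s = \<phi> s *\<^sub>R z + (1 - \<phi> s) *\<^sub>R apply_bcontfun g s" for s
    have h1: "norm (h s) \<le> 1" for s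
    proof -
      have "norm (apply_bcontfun g s) \<le> 1"
        using norm_bounded[of g s] g by linarith
      then have "h s \<in> cball 0 1"
        unfolding h_def using nz \<phi>[of s] by (intro convexD[OF convex_cball]) auto
      then show ?thesis
        by simp
    qed
    have "continuous_on UNIV h"
      unfolding h_def \<phi>_def using \<eta> by (intro continuous_intros) auto
    moreover have "bounded (range h)"
      using h1 by (auto simp: bounded_iff)
    ultimately have h: "apply_bcontfun (Bcontfun h) = h"
      by (auto simp: Bcontfun_inverse bcontfun_def)
    have "norm (Bcontfun h) \<le> 1"
      by (rule norm_bound) (simp add: h h1)
    \<comment> \<open>Since \<open>\<phi> t = 1\<close>, \<open>h t = z\<close>, so the functional
      takes the value \<open>f z\<close> at \<open>h\<close>.\<close>
    then have "Bcontfun h \<in> slice (eval_blinfun t f) \<epsilon>"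
      using fz \<phi>t by (auto simp: slice_def h h_def)
    then have "infdist g (slice (eval_blinfun t f) \<epsilon>) \<le> dist g (Bcontfun h)"
      by (rule infdist_le)
    also have "\<dots> \<le> dist ?y z + \<eta>"
    proof (rule dist_bound)
      fix s
      let ?d = "norm (apply_bcontfun g s - ?y)"
      have "dist (apply_bcontfun g s) (h s) = norm (\<phi> s *\<^sub>R (apply_bcontfun g s - z))"
        by (simp add: dist_norm h_def algebra_simps)
      also have "\<dots> = \<phi> s * norm (apply_bcontfun g s - z)"
        using \<phi>[of s] by simp
      also have "\<dots> \<le> \<phi> s * (?d + dist ?y z)"
        using \<phi>[of s] norm_triangle_ineq[of "apply_bcontfun g s - ?y" "?y - z"]
        by (intro mult_left_mono) (auto simp: dist_norm)
      also have "\<dots> \<le> \<eta> + dist ?y z"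
      \<comment> \<open>Within \<open>\<eta>\<close> of \<open>g t\<close>, the value
        \<open>g s\<close> is at most \<open>\<eta>\<close> further from \<open>z\<close> than
        \<open>g t\<close> is; elsewhere the bump vanishes and \<open>h s = g s\<close>.\<close>
      proof (cases "?d \<le> \<eta>")
        case True
        then have "\<phi> s * (?d + dist ?y z) \<le> 1 * (\<eta> + dist ?y z)"
          using \<phi>[of s] \<eta> by (intro mult_mono) auto
        then show ?thesis
          by simp
      next
        case False
        then have "\<phi> s = 0"
          using \<eta> by (auto simp: \<phi>_def field_simps)
        then show ?thesis
          using \<eta> by simp
      qed
      finally show "dist (apply_bcontfun g s) (apply_bcontfun (Bcontfun h) s) \<le> dist ?y z + \<eta>"
        by (simp add: h)
    qed
    finally show "infdist g (slice (eval_blinfun t f) \<epsilon>) \<le> dist ?y z + \<eta>" .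
  qed
qed

text \<open>Compactness of \<open>K\<close> enters here: the continuous function
  \<open>norm (g s)\<close> has a maximum, which is the supremum norm.\<close>

lemma bcontfun_attains_norm:
  fixes g :: "'k::topological_space \<Rightarrow>\<^sub>C 'e::real_normed_vector"
  assumes "compact (UNIV :: 'k set)"
  obtains t where "norm (apply_bcontfun g t) = norm g"
proof -
  have "continuous_on UNIV (\<lambda>s. norm (apply_bcontfun g s))"
    by (intro continuous_intros) auto
  then obtain t where "\<And>s. norm (apply_bcontfun g s) \<le> norm (apply_bcontfun g t)"
    using continuous_attains_sup[OF assms] by fast
  then have "norm g \<le> norm (apply_bcontfun g t)"
    by (intro norm_bound)
  then show thesis
    using that norm_bounded[of g t] by (metis antisym)
qed

theorem theorem2p10:
  assumes "compact (UNIV :: 'k::t2_space set)"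
    and "GL_space TYPE('e::banach)"
  shows "GL_space TYPE('k \<Rightarrow>\<^sub>C 'e)"
  unfolding GL_space_def
proof (intro ballI allI impI)
  fix u :: "'k \<Rightarrow>\<^sub>C 'e" and \<epsilon> :: real
  assume u: "u \<in> sphere 0 1" and \<epsilon>: "\<epsilon> > 0"
  obtain t where t: "norm (apply_bcontfun u t) = norm u"
    using bcontfun_attains_norm[OF assms(1)] .
  \<comment> \<open>Attainment puts \<open>u t\<close> on the unit sphere of \<open>E\<close>, where
    the GL-property supplies a functional.\<close>
  then have "apply_bcontfun u t \<in> sphere 0 1"
    using u by simp
  then obtain f :: "'e \<Rightarrow>\<^sub>L real" where f: "f \<in> sphere 0 1"
    and ut: "apply_bcontfun u t \<in> slice f \<epsilon>"
    and GL: "\<forall>y \<in> sphere 0 1. infdist y (slice f \<epsilon>) + infdist y (uminus ` slice f \<epsilon>) < 2 + \<epsilon>"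
    using assms(2) \<epsilon> unfolding GL_space_def by blast
  have ne: "slice f \<epsilon> \<noteq> {}"
    using ut by blast
  have sub: "slice f \<epsilon> \<subseteq> cball 0 1"
    by (auto simp: slice_def)
  let ?F = "eval_blinfun t f"
  show "\<exists>F \<in> sphere (0 :: ('k \<Rightarrow>\<^sub>C 'e) \<Rightarrow>\<^sub>L real) 1. u \<in> slice F \<epsilon> \<and>
      (\<forall>g \<in> sphere 0 1. infdist g (slice F \<epsilon>) + infdist g (uminus ` slice F \<epsilon>) < 2 + \<epsilon>)"
  proof (intro bexI[of _ ?F] conjI ballI)
    show "?F \<in> sphere 0 1"
      using f by simp
    show "u \<in> slice ?F \<epsilon>"
      using u ut by (simp add: slice_def)
    fix g :: "'k \<Rightarrow>\<^sub>C 'e" assume "g \<in> sphere 0 1"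
    then have g: "norm g \<le> 1" "norm (- g) \<le> 1"
      by auto
    let ?y = "apply_bcontfun g t"
    \<comment> \<open>The distance from \<open>g\<close> to the negative slice is that from
      \<open>- g\<close> to the slice, so one estimate, applied to \<open>g\<close> and
      \<open>- g\<close> at the same \<open>t\<close>, bounds both terms.\<close>
    have "infdist g (slice ?F \<epsilon>) + infdist g (uminus ` slice ?F \<epsilon>)
        \<le> infdist ?y (slice f \<epsilon>) + infdist (- ?y) (slice f \<epsilon>)"
      using infdist_slice_eval_blinfun_le[OF ne g(1), of t]
        infdist_slice_eval_blinfun_le[OF ne g(2), of t]
      by (simp add: infdist_uminus_image)
    also have "\<dots> < 2 + \<epsilon>"
    proof (rule infdist_add_infdist_uminus_less[OF ne sub \<epsilon>])
      show "norm ?y \<le> 1"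
        using norm_bounded[of g t] g by linarith
    qed (use GL in \<open>simp add: infdist_uminus_image\<close>)
    finally show "infdist g (slice ?F \<epsilon>) + infdist g (uminus ` slice ?F \<epsilon>) < 2 + \<epsilon>" .
  qed
qed

end
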